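(* Let $0\le a,b\le 1$ and let $T=\begin{pmatrix} a & 1-b\\ 1-a & b\end{pmatrix}$. Then the restricted distinguishability number is $$\tilde{\mathcal{M}}(T)=\begin{cases}1 & \text{if } \tfrac12<|a-b|\le 1,\\ 2 & \text{if } 0\le|a-b|\le\tfrac12.\end{cases}$$
   Context: Fix an orthonormal basis of $\mathbb{C}^2$, whose vectors are denoted $|k\rangle$. A qubit quantum channel is a completely positive trace-preserving linear map $\Phi$ on $2\times2$ complex matrices. Its classical action is the (column-)stochastic $2\times 2$ matrix $T$ with $T_{kl}=\langle k|\Phi(|l\rangle\langle l|)|k\rangle$. A set of channels $\{\Phi^{(n)}\}_{n=1}^M$ is perfectly distinguishable without using entangled input states if there is a pure state $|\psi\rangle\in\mathbb{C}^2$ such that the output states $\Phi^{(n)}(|\psi\rangle\langle\psi|)$, $n=1,\dots,M$, have pairwise orthogonal supports. The restricted distinguishability number $\tilde{\mathcal{M}}(T)$ is the maximal number of quantum channels that all have classical action $T$ and that are perfectly distinguishable without using entangled input states. *)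

theory Defs
  imports "HOL-Analysis.Analysis" "HOL-Library.Extended_Nat"
begin

text \<open>The inner product of \<^typ>\<open>complex^'n\<close>, conjugate linear in the first argument;
  the library operation \<open>\<bullet>\<close> is only its real part.\<close>

definition cinner :: "complex^'n::finite \<Rightarrow> complex^'n \<Rightarrow> complex" where
  "cinner u v = (\<Sum>i\<in>UNIV. cnj (u $ i) * v $ i)"

definition ketbra :: "complex^'n::finite \<Rightarrow> complex^'n \<Rightarrow> complex^'n^'n" where
  "ketbra u v = (\<chi> i j. u $ i * cnj (v $ j))"

definition orthonormal_basis :: "('n::finite \<Rightarrow> complex^'n) \<Rightarrow> bool" where
  "orthonormal_basis e \<longleftrightarrow> (\<forall>k l. cinner (e k) (e l) = (if k = l then 1 else 0))"

text \<open>Scalar multiplication of matrices by complex numbers (\<open>*s\<close> would expect a row as scalar).\<close>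

definition cscale :: "complex \<Rightarrow> complex^'n::finite^'n \<Rightarrow> complex^'n^'n" where
  "cscale c A = (\<chi> i j. c * A $ i $ j)"

lemma vector_space_cscale: "vector_space cscale"
  by unfold_locales (simp_all add: cscale_def vec_eq_iff algebra_simps)

text \<open>A family \<open>X i j\<close> (\<open>i, j < m\<close>) of matrices stands for the block matrix
  \<open>\<Sum>i j. X i j \<otimes> |i><j|\<close>, an arbitrary operator on \<open>\<complex>\<^sup>n \<otimes> \<complex>\<^sup>m\<close>; a family \<open>v i\<close> of vectors
  stands for the vector \<open>\<Sum>i. v i \<otimes> |i>\<close>. Positivity means positive semidefiniteness, and
  \<open>\<Phi> \<otimes> id\<close> acts by applying \<open>\<Phi>\<close> to every block.\<close>

definition block_psd :: "nat \<Rightarrow> (nat \<Rightarrow> nat \<Rightarrow> complex^'n::finite^'n) \<Rightarrow> bool" where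
  "block_psd m X \<longleftrightarrow>
     (\<forall>v :: nat \<Rightarrow> complex^'n. (\<Sum>i<m. \<Sum>j<m. cinner (v i) (X i j *v v j)) \<in> \<real>\<^sub>\<ge>\<^sub>0)"

definition completely_positive :: "(complex^'n::finite^'n \<Rightarrow> complex^'n^'n) \<Rightarrow> bool" where
  "completely_positive \<Phi> \<longleftrightarrow>
     (\<forall>m X. block_psd m X \<longrightarrow> block_psd m (\<lambda>i j. \<Phi> (X i j)))"

definition trace_preserving :: "(complex^'n::finite^'n \<Rightarrow> complex^'n^'n) \<Rightarrow> bool" where
  "trace_preserving \<Phi> \<longleftrightarrow> (\<forall>A. trace (\<Phi> A) = trace A)"

definition quantum_channel :: "(complex^'n::finite^'n \<Rightarrow> complex^'n^'n) \<Rightarrow> bool" where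
  "quantum_channel \<Phi> \<longleftrightarrow>
     Vector_Spaces.linear cscale cscale \<Phi> \<and> completely_positive \<Phi> \<and> trace_preserving \<Phi>"

definition classical_action ::
    "('n::finite \<Rightarrow> complex^'n) \<Rightarrow> (complex^'n^'n \<Rightarrow> complex^'n^'n) \<Rightarrow> complex^'n^'n" where
  "classical_action e \<Phi> = (\<chi> k l. cinner (e k) (\<Phi> (ketbra (e l) (e l)) *v e k))"

definition has_classical_action ::
    "('n::finite \<Rightarrow> complex^'n) \<Rightarrow> real^'n^'n \<Rightarrow> (complex^'n^'n \<Rightarrow> complex^'n^'n) \<Rightarrow> bool" where
  "has_classical_action e T \<Phi> \<longleftrightarrow>
     (\<forall>k l. classical_action e \<Phi> $ k $ l = complex_of_real (T $ k $ l))"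

text \<open>The support of a Hermitian matrix is its range, the orthogonal complement of its kernel.\<close>

definition support :: "complex^'n::finite^'n \<Rightarrow> (complex^'n) set" where
  "support \<rho> = range (\<lambda>v. \<rho> *v v)"

definition orthogonal_supports :: "complex^'n::finite^'n \<Rightarrow> complex^'n^'n \<Rightarrow> bool" where
  "orthogonal_supports \<rho> \<sigma> \<longleftrightarrow> (\<forall>u \<in> support \<rho>. \<forall>v \<in> support \<sigma>. cinner u v = 0)"

definition perfectly_distinguishable_unentangled ::
    "(complex^'n::finite^'n \<Rightarrow> complex^'n^'n) set \<Rightarrow> bool" where
  "perfectly_distinguishable_unentangled S \<longleftrightarrow>
     (\<exists>\<psi> :: complex^'n. norm \<psi> = 1 \<and>
        pairwise (\<lambda>\<Phi> \<Psi>. orthogonal_supports (\<Phi> (ketbra \<psi> \<psi>)) (\<Psi> (ketbra \<psi> \<psi>))) S)"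

text \<open>The supremum is taken in \<^typ>\<open>enat\<close>, so that a finite value is an attained maximum
  and unboundedness would give \<open>\<infinity>\<close>.\<close>

definition restricted_distinguishability_number ::
    "('n::finite \<Rightarrow> complex^'n) \<Rightarrow> real^'n^'n \<Rightarrow> enat" where
  "restricted_distinguishability_number e T =
     Sup {enat (card S) | S :: (complex^'n^'n \<Rightarrow> complex^'n^'n) set.
            finite S \<and> (\<forall>\<Phi>\<in>S. quantum_channel \<Phi> \<and> has_classical_action e T \<Phi>) \<and>
            perfectly_distinguishable_unentangled S}"

end

theory Submission
  imports Defs
begin

text \<open>Two states of a qubit with orthogonal supports add up to the identity. Hence there are never
  three pairwise orthogonal outputs, and if two channels are distinguished, then for each \<open>k\<close> the two
  probabilities of finding \<open>|k>\<close> in the output add up to 1. Each of these probabilities is at most the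
  sum of the \<open>k\<close>-th row of \<open>T\<close> (the diagonal entry of \<open>\<Phi> 1\<close>), and some row sum is below \<open>1/2\<close> if \<open>|a - b| > 1/2\<close>.
  Otherwise some row \<open>(\<alpha>, \<beta>)\<close> has a sum in \<open>[1/2, 1]\<close>. The effect of that outcome can be taken as
  \<open>|m><m|\<close> with \<open>m = (\<surd>\<alpha>, \<surd>\<beta>)\<close>, and as \<open>\<parallel>m\<parallel>\<^sup>2 \<ge> 1/2\<close>, some input makes both outcomes equally likely.
  The channel can be arranged to have a pure output on it, an equal superposition of the two basis
  states; a phase flip then yields a second channel with the orthogonal output.\<close>

section \<open>Sesquilinear algebra\<close>

lemma cinner_simps:
  "cinner (u + v) w = cinner u w + cinner v w"
  "cinner u (v + w) = cinner u v + cinner u w"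
  "cinner (c *s u) v = cnj c * cinner u v"
  "cinner u (c *s v) = c * cinner u v"
  "cinner 0 v = 0"
  "cinner u 0 = 0"
  by (simp_all add: cinner_def sum.distrib sum_distrib_left algebra_simps)

lemma cinner_sum_right: "cinner u (\<Sum>i\<in>I. f i) = (\<Sum>i\<in>I. cinner u (f i))"
  by (induction I rule: infinite_finite_induct) (simp_all add: cinner_simps)

lemma cnj_cinner: "cnj (cinner u v) = cinner v u"
  by (simp add: cinner_def mult.commute)

lemma cinner_self: "cinner v v = complex_of_real ((norm v)\<^sup>2)"
  by (simp add: cinner_def norm_vec_def L2_set_def complex_norm_square mult.commute
      sum_nonneg flip: of_real_power)

lemma cinner_self_eq_0_iff: "cinner v v = 0 \<longleftrightarrow> v = 0"
  by (simp add: cinner_self)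

lemma ketbra_mult_vec: "ketbra u v *v w = cinner v w *s u"
  by (simp add: ketbra_def cinner_def matrix_vector_mult_def vec_eq_iff sum_distrib_left
      mult.commute mult.left_commute)

lemma matrix_vector_mult_axis: "(A *v axis j 1) $ i = A $ i $ j"
  for A :: "complex^'n::finite^'m::finite"
  by (simp add: matrix_vector_mult_def axis_def if_distrib cong: if_cong)

lemma matrix_sum_vec: "(\<Sum>i\<in>I. A i) *v v = (\<Sum>i\<in>I. A i *v v)"
  for A :: "'i \<Rightarrow> complex^'n::finite^'m::finite"
  by (induction I rule: infinite_finite_induct)
    (simp_all add: matrix_vector_mult_add_rdistrib)

text \<open>With the basis vectors as columns of \<open>U\<close>, orthonormality says that the
  adjoint \<open>V\<close> is a left inverse. For square matrices it is then a right inverse, and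
  \<open>U ** V\<close> is the sum of the projections.\<close>

lemma ketbra_sum_orthonormal_basis:
  fixes e :: "'n::finite \<Rightarrow> complex^'n"
  assumes "orthonormal_basis e"
  shows "(\<Sum>k\<in>UNIV. ketbra (e k) (e k)) = mat 1"
proof -
  define U :: "complex^'n^'n" where "U = (\<chi> i k. e k $ i)"
  define V :: "complex^'n^'n" where "V = (\<chi> k i. cnj (e k $ i))"
  have "V ** U = mat 1"
    using assms by (simp add: orthonormal_basis_def cinner_def U_def V_def matrix_matrix_mult_def
        mat_def vec_eq_iff)
  then have "U ** V = mat 1"
    using matrix_left_right_inverse by blast
  then show ?thesis
    by (simp add: U_def V_def matrix_matrix_mult_def ketbra_def vec_eq_iff)
qed

lemma orthonormal_basis_2:
  fixes f :: "2 \<Rightarrow> complex^2"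
  shows "orthonormal_basis f \<longleftrightarrow>
     cinner (f 1) (f 1) = 1 \<and> cinner (f 2) (f 2) = 1 \<and> cinner (f 1) (f 2) = 0"
proof -
  have "cinner (f 2) (f 1) = cnj (cinner (f 1) (f 2))"
    by (simp add: cnj_cinner)
  then show ?thesis
    unfolding orthonormal_basis_def forall_2 by auto
qed

lemma exists_orthonormal_partner:
  fixes \<psi> :: "complex^2"
  assumes "norm \<psi> = 1"
  obtains \<phi> where "ketbra \<psi> \<psi> + ketbra \<phi> \<phi> = mat 1"
proof -
  define \<phi> :: "complex^2" where "\<phi> = vector [- cnj (\<psi> $ 2), cnj (\<psi> $ 1)]"
  define f :: "2 \<Rightarrow> complex^2" where "f = (\<lambda>k. if k = 1 then \<psi> else \<phi>)"
  have "cinner \<psi> \<psi> = 1"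
    using assms by (simp add: cinner_self)
  moreover have "cinner \<phi> \<phi> = cinner \<psi> \<psi>" "cinner \<psi> \<phi> = 0"
    by (simp_all add: \<phi>_def cinner_def sum_2 mult.commute)
  ultimately have "orthonormal_basis f"
    by (simp add: orthonormal_basis_2 f_def)
  from ketbra_sum_orthonormal_basis[OF this] show thesis
    by (intro that) (simp add: sum_2 f_def)
qed

section \<open>Kraus maps\<close>

lemma matrix_mult_add_left: "(A + B) ** C = A ** C + B ** C"
  for A B :: "complex^'n::finite^'m::finite" and C :: "complex^'k::finite^'n"
  by (simp add: matrix_matrix_mult_def vec_eq_iff sum.distrib distrib_right)

definition adjoint_matrix :: "complex^'n::finite^'m::finite \<Rightarrow> complex^'m^'n" where
  "adjoint_matrix A = (\<chi> i j. cnj (A $ j $ i))"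

lemma cinner_adjoint_matrix: "cinner u (A *v v) = cinner (adjoint_matrix A *v u) v"
proof -
  have "cinner u (A *v v) = (\<Sum>i\<in>UNIV. \<Sum>j\<in>UNIV. cnj (u $ i) * A $ i $ j * v $ j)"
    by (simp add: cinner_def matrix_vector_mult_def sum_distrib_left algebra_simps)
  also have "\<dots> = (\<Sum>j\<in>UNIV. \<Sum>i\<in>UNIV. cnj (u $ i) * A $ i $ j * v $ j)"
    by (rule sum.swap)
  also have "\<dots> = cinner (adjoint_matrix A *v u) v"
    by (simp add: cinner_def matrix_vector_mult_def adjoint_matrix_def sum_distrib_left
        algebra_simps)
  finally show ?thesis .
qed

lemma adjoint_matrix_ketbra: "adjoint_matrix (ketbra u v) = ketbra v u"
  by (simp add: adjoint_matrix_def ketbra_def vec_eq_iff mult.commute)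

lemma adjoint_matrix_add: "adjoint_matrix (A + B) = adjoint_matrix A + adjoint_matrix B"
  by (simp add: adjoint_matrix_def vec_eq_iff)

lemma matrix_mult_ketbra: "A ** ketbra u v = ketbra (A *v u) v"
  by (simp add: matrix_matrix_mult_def matrix_vector_mult_def ketbra_def vec_eq_iff
      sum_distrib_right mult.assoc)

lemma ketbra_mult_adjoint_matrix: "ketbra u v ** adjoint_matrix A = ketbra u (A *v v)"
  by (simp add: matrix_matrix_mult_def matrix_vector_mult_def ketbra_def adjoint_matrix_def
      vec_eq_iff sum_distrib_left mult.assoc mult.commute[of "cnj (A $ _ $ _)"])

definition kraus_map ::
    "'i set \<Rightarrow> ('i \<Rightarrow> complex^'n::finite^'n) \<Rightarrow> complex^'n^'n \<Rightarrow> complex^'n^'n" where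
  "kraus_map I K A = (\<Sum>i\<in>I. K i ** A ** adjoint_matrix (K i))"

lemma kraus_map_ketbra:
  "kraus_map I K (ketbra u v) = (\<Sum>i\<in>I. ketbra (K i *v u) (K i *v v))"
  by (simp add: kraus_map_def matrix_mult_ketbra ketbra_mult_adjoint_matrix)

text \<open>Each Kraus operator can be moved onto the test vectors as its adjoint, so the form of
  the image at \<open>v\<close> is a sum over \<open>k\<close> of forms of \<open>X\<close> at
  \<open>w k\<close>, all nonnegative.\<close>

lemma completely_positive_kraus_map:
  fixes K :: "'i \<Rightarrow> complex^'n::finite^'n"
  shows "completely_positive (kraus_map I K)"
  unfolding completely_positive_def block_psd_def
proof (intro allI impI)
  fix m :: nat and X :: "nat \<Rightarrow> nat \<Rightarrow> complex^'n^'n" and v :: "nat \<Rightarrow> complex^'n"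
  assume psd: "\<forall>v :: nat \<Rightarrow> complex^'n.
    (\<Sum>i<m. \<Sum>j<m. cinner (v i) (X i j *v v j)) \<in> \<real>\<^sub>\<ge>\<^sub>0"
  define w where "w k i = adjoint_matrix (K k) *v v i" for k i
  have eq: "cinner (v i) (kraus_map I K (X i j) *v v j) = (\<Sum>k\<in>I. cinner (w k i) (X i j *v w k j))"
    for i j
    by (simp add: kraus_map_def matrix_sum_vec cinner_sum_right w_def cinner_adjoint_matrix
        flip: matrix_vector_mul_assoc)
  have "(\<Sum>i<m. \<Sum>j<m. cinner (v i) (kraus_map I K (X i j) *v v j))
      = (\<Sum>i<m. \<Sum>k\<in>I. \<Sum>j<m. cinner (w k i) (X i j *v w k j))"
    unfolding eq by (intro sum.cong refl sum.swap)
  also have "\<dots> = (\<Sum>k\<in>I. \<Sum>i<m. \<Sum>j<m. cinner (w k i) (X i j *v w k j))"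
    by (rule sum.swap)
  also have "\<dots> \<in> \<real>\<^sub>\<ge>\<^sub>0"
    using psd by (induction I rule: infinite_finite_induct) auto
  finally show "(\<Sum>i<m. \<Sum>j<m. cinner (v i) (kraus_map I K (X i j) *v v j)) \<in> \<real>\<^sub>\<ge>\<^sub>0" .
qed

lemma trace_kraus_map:
  "trace (kraus_map I K A) = trace ((\<Sum>i\<in>I. adjoint_matrix (K i) ** K i) ** A)"
proof (induction I rule: infinite_finite_induct)
  case (insert i I)
  have "trace (K i ** A ** adjoint_matrix (K i)) = trace (adjoint_matrix (K i) ** K i ** A)"
    by (metis matrix_mul_assoc trace_mul_sym)
  with insert show ?case
    by (simp add: kraus_map_def trace_add matrix_mult_add_left)
qed (simp_all add: kraus_map_def)

lemma linear_kraus_map: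
  fixes K :: "'i \<Rightarrow> complex^'n::finite^'n"
  shows "Vector_Spaces.linear cscale cscale (kraus_map I K)"
proof -
  have "K i ** cscale c A ** adjoint_matrix (K i) = cscale c (K i ** A ** adjoint_matrix (K i))"
    for i c A
    by (simp add: cscale_def matrix_matrix_mult_def vec_eq_iff sum_distrib_left sum_distrib_right
        algebra_simps)
  moreover have "cscale c (\<Sum>i\<in>I. f i) = (\<Sum>i\<in>I. cscale c (f i))" for c and f :: "'i \<Rightarrow> complex^'n^'n"
    by (simp add: cscale_def vec_eq_iff sum_distrib_left)
  ultimately show ?thesis
    by (simp add: Vector_Spaces.linear_iff vector_space_cscale kraus_map_def matrix_add_ldistrib
        matrix_mult_add_left sum.distrib)
qed

lemma quantum_channel_kraus_map:
  assumes "(\<Sum>i\<in>I. adjoint_matrix (K i) ** K i) = mat 1"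
  shows "quantum_channel (kraus_map I K)"
  using assms by (simp add: quantum_channel_def linear_kraus_map completely_positive_kraus_map
      trace_preserving_def trace_kraus_map)

lemma classical_action_kraus_map:
  "classical_action e (kraus_map I K) $ k $ l = (\<Sum>i\<in>I. (cmod (cinner (e k) (K i *v e l)))\<^sup>2)"
proof -
  have "cinner (K i *v e l) (e k) * cinner (e k) (K i *v e l)
      = (cmod (cinner (e k) (K i *v e l)))\<^sup>2" for i
    by (metis cnj_cinner complex_norm_square mult.commute)
  then show ?thesis
    by (simp add: classical_action_def kraus_map_ketbra matrix_sum_vec cinner_sum_right
        ketbra_mult_vec cinner_simps)
qed

text \<open>Measuring in the basis and then preparing a basis state according to \<open>T\<close> realizes \<open>T\<close>.\<close>

lemma exists_channel_with_classical_action: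
  fixes e :: "'n::finite \<Rightarrow> complex^'n" and T :: "real^'n^'n"
  assumes e: "orthonormal_basis e"
    and nonneg: "\<And>k l. 0 \<le> T $ k $ l" and stoch: "\<And>l. (\<Sum>k\<in>UNIV. T $ k $ l) = 1"
  obtains \<Phi> where "quantum_channel \<Phi>" "has_classical_action e T \<Phi>"
proof
  \<comment> \<open>One Kraus operator per transition from \<open>l\<close> to \<open>k\<close>; the
    square root is an amplitude whose squared modulus is the transition probability.\<close>
  define K where "K = (\<lambda>(k, l). ketbra (complex_of_real (sqrt (T $ k $ l)) *s e k) (e l))"
  define \<Phi> where "\<Phi> = kraus_map UNIV K"
  have ee: "cinner (e k) (e l) = (if k = l then 1 else 0)" for k l
    using e by (simp add: orthonormal_basis_def)
  have KK: "adjoint_matrix (K (k, l)) ** K (k, l) = cscale (T $ k $ l) (ketbra (e l) (e l))" for k l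
  proof -
    have "adjoint_matrix (K (k, l)) ** K (k, l) = ketbra (complex_of_real (T $ k $ l) *s e l) (e l)"
      using nonneg[of k l] by (simp add: K_def adjoint_matrix_ketbra matrix_mult_ketbra
          ketbra_mult_vec cinner_simps ee flip: of_real_mult)
    then show ?thesis
      by (simp add: cscale_def ketbra_def vec_eq_iff)
  qed
  have "(\<Sum>i\<in>UNIV. adjoint_matrix (K i) ** K i)
      = (\<Sum>k\<in>UNIV. \<Sum>l\<in>UNIV. cscale (T $ k $ l) (ketbra (e l) (e l)))"
    unfolding sum.cartesian_product UNIV_Times_UNIV
    by (intro sum.cong refl) (auto simp: KK)
  also have "\<dots> = (\<Sum>l\<in>UNIV. \<Sum>k\<in>UNIV. cscale (T $ k $ l) (ketbra (e l) (e l)))"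
    by (rule sum.swap)
  also have "\<dots> = (\<Sum>l\<in>UNIV. cscale (complex_of_real (\<Sum>k\<in>UNIV. T $ k $ l)) (ketbra (e l) (e l)))"
    by (simp add: cscale_def vec_eq_iff sum_distrib_right)
  also have "\<dots> = (\<Sum>l\<in>UNIV. ketbra (e l) (e l))"
    unfolding stoch by (simp add: cscale_def)
  finally show "quantum_channel \<Phi>"
    unfolding \<Phi>_def
    by (intro quantum_channel_kraus_map) (simp add: ketbra_sum_orthonormal_basis[OF e])
  have "(cmod (cinner (e k) (K (k', l') *v e l)))\<^sup>2
      = (if k' = k then if l' = l then T $ k $ l else 0 else 0)" for k l k' l'
    using nonneg by (simp add: K_def ketbra_mult_vec cinner_simps ee)
  then have "(\<Sum>i\<in>UNIV. (cmod (cinner (e k) (K i *v e l)))\<^sup>2)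
      = (\<Sum>k'\<in>UNIV. \<Sum>l'\<in>UNIV. if k' = k then if l' = l then T $ k $ l else 0 else 0)" for k l
    unfolding sum.cartesian_product UNIV_Times_UNIV by (intro sum.cong refl) auto
  also have "\<dots> k l = T $ k $ l" for k l
    by (simp add: if_distrib[of "sum _"] sum.If_cases)
  finally show "has_classical_action e T \<Phi>"
    by (simp add: has_classical_action_def \<Phi>_def classical_action_kraus_map flip: of_real_sum)
qed

section \<open>Orthogonal qubit outputs\<close>

text \<open>This is complete positivity for a single block.\<close>

lemma channel_output_psd:
  assumes "quantum_channel \<Phi>"
  shows "cinner v (\<Phi> (ketbra \<psi> \<psi>) *v v) \<in> \<real>\<^sub>\<ge>\<^sub>0"
proof -
  have "cinner u (ketbra \<psi> \<psi> *v u) = (cmod (cinner \<psi> u))\<^sup>2" for u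
    by (metis cinner_simps(4) cnj_cinner complex_norm_square ketbra_mult_vec)
  then have "block_psd 1 (\<lambda>_ _. ketbra \<psi> \<psi>)"
    by (simp add: block_psd_def)
  then have "block_psd 1 (\<lambda>_ _. \<Phi> (ketbra \<psi> \<psi>))"
    using assms by (auto simp: quantum_channel_def completely_positive_def)
  from this[unfolded block_psd_def, rule_format, of "\<lambda>_. v"] show ?thesis
    by simp
qed

lemma trace_ketbra: "trace (ketbra u v) = cinner v u"
  by (simp add: trace_def ketbra_def cinner_def mult.commute)

lemma trace_channel_output:
  assumes "quantum_channel \<Phi>" "norm \<psi> = 1"
  shows "trace (\<Phi> (ketbra \<psi> \<psi>)) = 1"
  using assms by (simp add: quantum_channel_def trace_preserving_def trace_ketbra cinner_self)

text \<open>Polarization with the test vectors \<open>|1> + |2>\<close> and \<open>|1> + i|2>\<close>.\<close>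

lemma hermitian_2_of_real_quadratic_form:
  fixes A :: "complex^2^2"
  assumes "\<And>v. cinner v (A *v v) \<in> \<real>"
  shows "A $ 2 $ 1 = cnj (A $ 1 $ 2)" "A $ 1 $ 1 \<in> \<real>" "A $ 2 $ 2 \<in> \<real>"
proof -
  note q = assms[of "vector [_, _]", simplified cinner_def matrix_vector_mult_def sum_2, simplified]
  show 1: "A $ 1 $ 1 \<in> \<real>" "A $ 2 $ 2 \<in> \<real>"
    using q[of 1 0] q[of 0 1] by simp_all
  show "A $ 2 $ 1 = cnj (A $ 1 $ 2)"
    using 1 q[of 1 1] q[of 1 \<i>] by (simp add: complex_is_Real_iff complex_eq_iff)
qed

text \<open>Orthogonality makes every column of \<open>A\<close> orthogonal to every column of
  \<open>B\<close>. Hermiticity and unit trace reduce this to four equations in the diagonal entries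
  \<open>p\<close>, \<open>q\<close> and the off-diagonal entries \<open>z\<close>,
  \<open>w\<close>, which force \<open>q = 1 - p\<close> and \<open>w = - z\<close>.\<close>

lemma orthogonal_states_sum:
  fixes A B :: "complex^2^2"
  assumes A: "\<And>v. cinner v (A *v v) \<in> \<real>" "trace A = 1"
    and B: "\<And>v. cinner v (B *v v) \<in> \<real>" "trace B = 1"
    and orth: "orthogonal_supports A B"
  shows "A + B = mat 1"
proof -
  note hA = hermitian_2_of_real_quadratic_form[OF A(1)]
  note hB = hermitian_2_of_real_quadratic_form[OF B(1)]
  have "cinner (A *v axis i 1) (B *v axis j 1) = 0" for i j
    using orth by (auto simp: orthogonal_supports_def support_def)
  then have AB: "cnj (A $ 1 $ i) * B $ 1 $ j + cnj (A $ 2 $ i) * B $ 2 $ j = 0" for i j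
    by (simp add: cinner_def sum_2 matrix_vector_mult_axis)
  define p q z w where "p = A $ 1 $ 1" "q = B $ 1 $ 1" "z = A $ 1 $ 2" "w = B $ 1 $ 2"
  have A22: "A $ 2 $ 2 = 1 - p" and B22: "B $ 2 $ 2 = 1 - q"
    using A(2) B(2) by (simp_all add: trace_def sum_2 p_q_z_w_def algebra_simps)
  have p: "cnj p = p" and q: "cnj q = q"
    using hA hB by (simp_all add: p_q_z_w_def Reals_cnj_iff)
  have e: "p * q + z * cnj w = 0" "cnj z * w + (1 - p) * (1 - q) = 0"
      "p * w + z * (1 - q) = 0" "cnj z * q + (1 - p) * cnj w = 0"
    using AB[of 1 1] AB[of 2 2] AB[of 1 2] AB[of 2 1] hA(1) hB(1) A22 B22 p
    by (simp_all flip: p_q_z_w_def)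
  \<comment> \<open>Conjugation produces the same product \<open>z * cnj w\<close> as in the first
    equation. Eliminating it leaves a relation whose quadratic terms cancel.\<close>
  have "cnj (cnj z * w + (1 - p) * (1 - q)) = 0"
    using e(2) by simp
  then have "z * cnj w + (1 - p) * (1 - q) = 0"
    by (simp add: p q)
  then have "p * q = (1 - p) * (1 - q)"
    using e(1) by (metis add.commute add_left_cancel)
  then have pq: "q = 1 - p"
    by (simp add: algebra_simps)
  \<comment> \<open>The two off-diagonal equations become \<open>(1 - p) * (z + w) = 0\<close> and
    \<open>p * (z + w) = 0\<close>; adding them avoids a case distinction on
    \<open>p\<close>.\<close>
  have "cnj (cnj z * q + (1 - p) * cnj w) = 0"
    using e(4) by simp
  then have "z * (1 - p) + (1 - p) * w = 0"
    by (simp add: p pq)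
  moreover have "p * w + z * p = 0"
    using e(3) by (simp add: pq)
  ultimately have "z + w = 0"
    by (simp add: algebra_simps)
  moreover from this have "cnj z + cnj w = 0"
    by (metis complex_cnj_add complex_cnj_zero)
  ultimately show ?thesis
    using hA(1) hB(1) A22 B22 pq by (simp add: vec_eq_iff forall_2 mat_def flip: p_q_z_w_def)
qed

text \<open>Every vector in the range is orthogonal to itself, so the matrix vanishes. Hence outputs
  of trace 1 with orthogonal supports are never equal.\<close>

lemma orthogonal_supports_self:
  assumes "orthogonal_supports A A"
  shows "trace A = 0"
proof -
  have "A *v v = 0" for v
    using assms by (simp add: orthogonal_supports_def support_def flip: cinner_self_eq_0_iff)
  then have "A = 0"
    by (simp add: matrix_eq)
  then show ?thesis
    by (simp add: trace_def)
qed

lemma orthogonal_channel_outputs_sum: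
  fixes \<Phi> \<Psi> :: "complex^2^2 \<Rightarrow> complex^2^2"
  assumes "quantum_channel \<Phi>" "quantum_channel \<Psi>" "norm \<psi> = 1"
    and "orthogonal_supports (\<Phi> (ketbra \<psi> \<psi>)) (\<Psi> (ketbra \<psi> \<psi>))"
  shows "\<Phi> (ketbra \<psi> \<psi>) + \<Psi> (ketbra \<psi> \<psi>) = mat 1"
  using assms by (intro orthogonal_states_sum)
    (auto simp: trace_channel_output dest: channel_output_psd intro: nonneg_Reals_Real)

text \<open>Of three outputs, the second and the third would both be the complement of the first,
  hence equal and yet orthogonal.\<close>

lemma card_distinguishable_le_2:
  fixes S :: "(complex^2^2 \<Rightarrow> complex^2^2) set"
  assumes "finite S" "\<And>\<Phi>. \<Phi> \<in> S \<Longrightarrow> quantum_channel \<Phi>" "perfectly_distinguishable_unentangled S"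
  shows "card S \<le> 2"
proof (rule ccontr)
  assume "\<not> card S \<le> 2"
  then have "3 \<le> card S"
    by simp
  then obtain A where "A \<subseteq> S" "card A = 3"
    by (meson obtain_subset_with_card_n)
  then obtain \<Phi> \<Psi> \<Omega> where S: "\<Phi> \<in> S" "\<Psi> \<in> S" "\<Omega> \<in> S" "\<Phi> \<noteq> \<Psi>" "\<Phi> \<noteq> \<Omega>" "\<Psi> \<noteq> \<Omega>"
    by (auto simp: card_3_iff)
  from assms(3) obtain \<psi> where \<psi>: "norm \<psi> = 1"
    and pw: "pairwise (\<lambda>\<Phi> \<Psi>. orthogonal_supports (\<Phi> (ketbra \<psi> \<psi>)) (\<Psi> (ketbra \<psi> \<psi>))) S"
    unfolding perfectly_distinguishable_unentangled_def by blast
  let ?\<rho> = "ketbra \<psi> \<psi>"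
  have "\<Phi> ?\<rho> + \<Psi> ?\<rho> = mat 1" "\<Phi> ?\<rho> + \<Omega> ?\<rho> = mat 1"
    using S pw \<psi> assms(2) by (auto intro!: orthogonal_channel_outputs_sum simp: pairwise_def)
  then have "\<Psi> ?\<rho> = \<Omega> ?\<rho>"
    by (metis add_left_cancel)
  moreover have "orthogonal_supports (\<Psi> ?\<rho>) (\<Omega> ?\<rho>)"
    using S pw by (auto simp: pairwise_def)
  ultimately have "trace (\<Psi> ?\<rho>) = 0"
    using orthogonal_supports_self by metis
  then show False
    using trace_channel_output[OF assms(2)[OF S(2)] \<psi>] by simp
qed

text \<open>The output probability is at most the \<open>k\<close>-th diagonal entry of \<open>\<Phi> 1\<close>, since
  \<open>1 - |\<psi>><\<psi>|\<close> is again positive.\<close>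

lemma output_probability_le_row_sum:
  fixes e :: "2 \<Rightarrow> complex^2" and \<Phi> :: "complex^2^2 \<Rightarrow> complex^2^2"
  assumes e: "orthonormal_basis e" and \<Phi>: "quantum_channel \<Phi>" "has_classical_action e T \<Phi>"
    and \<psi>: "norm \<psi> = 1"
  shows "Re (cinner (e k) (\<Phi> (ketbra \<psi> \<psi>) *v e k)) \<le> (\<Sum>l\<in>UNIV. T $ k $ l)"
proof -
  obtain \<phi> where \<phi>: "ketbra \<psi> \<psi> + ketbra \<phi> \<phi> = mat 1"
    using exists_orthonormal_partner[OF \<psi>] .
  have add: "\<Phi> (A + B) = \<Phi> A + \<Phi> B" for A B
    using \<Phi>(1) by (simp add: quantum_channel_def Vector_Spaces.linear_iff)
  define g where "g A = cinner (e k) (\<Phi> A *v e k)" for A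
  have g_add: "g (A + B) = g A + g B" for A B
    by (simp add: g_def add matrix_vector_mult_add_rdistrib cinner_simps)
  \<comment> \<open>Both sides are \<open>g (mat 1)\<close>, from two resolutions of the
    identity.\<close>
  have "g (ketbra \<psi> \<psi>) + g (ketbra \<phi> \<phi>) = g (ketbra (e 1) (e 1)) + g (ketbra (e 2) (e 2))"
    using ketbra_sum_orthonormal_basis[OF e] \<phi> by (simp add: sum_2 flip: g_add)
  moreover have "g (ketbra (e l) (e l)) = T $ k $ l" for l
    using \<Phi>(2) by (simp add: has_classical_action_def classical_action_def g_def)
  ultimately have "Re (g (ketbra \<psi> \<psi>)) + Re (g (ketbra \<phi> \<phi>)) = (\<Sum>l\<in>UNIV. T $ k $ l)"
    by (simp add: sum_2 complex_eq_iff)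
  moreover have "0 \<le> Re (g (ketbra \<phi> \<phi>))"
    using channel_output_psd[OF \<Phi>(1)] by (simp add: g_def complex_nonneg_Reals_iff)
  ultimately show ?thesis
    by (simp add: g_def)
qed

lemma card_distinguishable_le_1:
  fixes S :: "(complex^2^2 \<Rightarrow> complex^2^2) set" and e :: "2 \<Rightarrow> complex^2"
  assumes e: "orthonormal_basis e" and "finite S"
    and S: "\<And>\<Phi>. \<Phi> \<in> S \<Longrightarrow> quantum_channel \<Phi>" "\<And>\<Phi>. \<Phi> \<in> S \<Longrightarrow> has_classical_action e T \<Phi>"
    and "perfectly_distinguishable_unentangled S"
    and row: "(\<Sum>l\<in>UNIV. T $ k $ l) < 1 / 2"
  shows "card S \<le> 1"
proof (rule ccontr)
  assume "\<not> card S \<le> 1"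
  then obtain \<Phi> \<Psi> where \<Phi>\<Psi>: "\<Phi> \<in> S" "\<Psi> \<in> S" "\<Phi> \<noteq> \<Psi>"
    using assms(2) by (metis One_nat_def card_le_Suc0_iff_eq)
  obtain \<psi> where \<psi>: "norm \<psi> = 1"
    and pw: "pairwise (\<lambda>\<Phi> \<Psi>. orthogonal_supports (\<Phi> (ketbra \<psi> \<psi>)) (\<Psi> (ketbra \<psi> \<psi>))) S"
    using assms(5) unfolding perfectly_distinguishable_unentangled_def by blast
  let ?p = "\<lambda>\<Phi>. cinner (e k) (\<Phi> (ketbra \<psi> \<psi>) *v e k)"
  have "\<Phi> (ketbra \<psi> \<psi>) + \<Psi> (ketbra \<psi> \<psi>) = mat 1"
    using \<Phi>\<Psi> pw \<psi> S by (auto intro!: orthogonal_channel_outputs_sum simp: pairwise_def)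
  then have "?p \<Phi> + ?p \<Psi> = cinner (e k) (mat 1 *v e k)"
    by (metis cinner_simps(2) matrix_vector_mult_add_rdistrib)
  also have "\<dots> = 1"
    using e by (simp add: orthonormal_basis_def)
  finally have "Re (?p \<Phi>) + Re (?p \<Psi>) = 1"
    by (metis one_complex.sel(1) plus_complex.sel(1))
  moreover have "Re (?p \<Phi>) < 1 / 2" "Re (?p \<Psi>) < 1 / 2"
    using output_probability_le_row_sum[OF e S \<psi>, of \<Phi> k]
      output_probability_le_row_sum[OF e S \<psi>, of \<Psi> k] \<Phi>\<Psi> row by simp_all
  ultimately show False
    by simp
qed

section \<open>Two distinguishable channels\<close>

text \<open>With \<open>s = \<alpha> + \<beta>\<close>, the unit vector \<open>u\<close> along \<open>m\<close> and its rotation \<open>u'\<close> by a right angle: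
  \<open>p = x u + y u'\<close> is chosen with \<open>(m \<bullet> p)\<^sup>2 = 1/2\<close>, \<open>n\<close> is \<open>\<surd>2\<close> times the image of \<open>p\<close> under
  \<open>1 - m m\<^sup>T\<close>, and \<open>q\<close> accounts for the remaining rank-one part, which annihilates \<open>p\<close>.\<close>

lemma rank_one_resolution:
  fixes \<alpha> \<beta> :: real
  assumes "0 \<le> \<alpha>" "0 \<le> \<beta>" "1/2 \<le> \<alpha> + \<beta>" "\<alpha> + \<beta> \<le> 1"
  obtains m1 m2 n1 n2 q1 q2 p1 p2 :: real where
    "m1\<^sup>2 = \<alpha>" "m2\<^sup>2 = \<beta>" "p1\<^sup>2 + p2\<^sup>2 = 1"
    "m1\<^sup>2 + n1\<^sup>2 + q1\<^sup>2 = 1" "m2\<^sup>2 + n2\<^sup>2 + q2\<^sup>2 = 1" "m1 * m2 + n1 * n2 + q1 * q2 = 0"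
    "q1 * p1 + q2 * p2 = 0" "(m1 * p1 + m2 * p2)\<^sup>2 = (n1 * p1 + n2 * p2)\<^sup>2"
proof -
  define s where "s = \<alpha> + \<beta>"
  have s: "1/2 \<le> s" "s \<le> 1" "0 < s"
    using assms by (simp_all add: s_def)
  \<comment> \<open>Here \<open>u = (c, d)\<close>, \<open>u' = (-d, c)\<close> and
    \<open>m = r u\<close>. The condition \<open>s * x\<^sup>2 = 1/2\<close> fixes \<open>x\<close>,
    and \<open>1/2 \<le> s\<close> keeps \<open>y\<close> real. The length \<open>t\<close> of
    \<open>q\<close> is fixed by the trace, as \<open>m\<close> and \<open>n\<close> both have
    squared length \<open>s\<close>; it is real since \<open>s \<le> 1\<close>.\<close>
  define r c d x y h t where "r = sqrt s" "c = sqrt (\<alpha> / s)" "d = sqrt (\<beta> / s)"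
    "x = sqrt (1 / (2 * s))" "y = sqrt (1 - 1 / (2 * s))" "h = sqrt 2" "t = sqrt (2 - 2 * s)"
  note defs = this
  have r: "r\<^sup>2 = s" and c: "c\<^sup>2 = \<alpha> / s" and d: "d\<^sup>2 = \<beta> / s" and x: "x\<^sup>2 = 1 / (2 * s)"
    and y: "y\<^sup>2 = 1 - 1 / (2 * s)" and h: "h\<^sup>2 = 2" and t: "t\<^sup>2 = 2 - 2 * s"
    using s assms by (simp_all add: defs)
  have cd: "c\<^sup>2 + d\<^sup>2 = 1"
    using s by (simp add: c d s_def flip: add_divide_distrib)
  have xy: "x\<^sup>2 + y\<^sup>2 = 1" "2 * s * x\<^sup>2 = 1"
    using s by (simp_all add: x y)
  \<comment> \<open>The entries, in the basis \<open>u\<close>, \<open>u'\<close>, of the sum of the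
    projectors \<open>m m^T + n n^T + q q^T\<close>, which has to be the identity.\<close>
  define g11 g12 g22 where
    "g11 = r\<^sup>2 + (h * (1 - s) * x)\<^sup>2 + (t * y)\<^sup>2"
    "g12 = h * (1 - s) * x * (h * y) - t * y * (t * x)"
    "g22 = (h * y)\<^sup>2 + (t * x)\<^sup>2"
  note gdefs = this
  have g22: "g22 = 1"
    using xy by (simp add: gdefs power_mult_distrib h t) (simp add: algebra_simps)
  have "g12 = (h\<^sup>2 * (1 - s) - t\<^sup>2) * (x * y)"
    by (simp add: gdefs power2_eq_square algebra_simps)
  then have g12: "g12 = 0"
    by (simp add: h t)
  have "g11 = s + 2 * (1 - s)\<^sup>2 * x\<^sup>2 + (2 - 2 * s) * (1 - x\<^sup>2)"
    by (simp add: gdefs power_mult_distrib r h t flip: xy(1))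
  also have "\<dots> = 2 - s - (1 - s) * (2 * s * x\<^sup>2)"
    by (simp add: power2_eq_square algebra_simps)
  finally have g11: "g11 = 1"
    unfolding xy(2) by simp
  show thesis
  proof (rule that)
    \<comment> \<open>Back to standard coordinates. In the rotated basis \<open>n\<close> is
      \<open>h ((1 - s) x, y)\<close>, \<open>p\<close> is \<open>(x, y)\<close>, and
      \<open>q\<close> is \<open>t (-y, x)\<close>, orthogonal to \<open>p\<close>.\<close>
    define n1 n2 q1 q2 p1 p2 where
      "n1 = h * (1 - s) * x * c - h * y * d" "n2 = h * (1 - s) * x * d + h * y * c"
      "q1 = - t * y * c - t * x * d" "q2 = - t * y * d + t * x * c"
      "p1 = x * c - y * d" "p2 = x * d + y * c"
    note nqp = this
    show "(r * c)\<^sup>2 = \<alpha>" "(r * d)\<^sup>2 = \<beta>"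
      using s by (simp_all add: power_mult_distrib r c d)
    have "p1\<^sup>2 + p2\<^sup>2 = (x\<^sup>2 + y\<^sup>2) * (c\<^sup>2 + d\<^sup>2)"
      by (simp add: nqp power2_eq_square algebra_simps)
    then show "p1\<^sup>2 + p2\<^sup>2 = 1"
      by (simp add: xy cd)
    have "(r * c)\<^sup>2 + n1\<^sup>2 + q1\<^sup>2 = c\<^sup>2 * g11 - 2 * c * d * g12 + d\<^sup>2 * g22"
      by (simp add: nqp gdefs power2_eq_square algebra_simps)
    then show "(r * c)\<^sup>2 + n1\<^sup>2 + q1\<^sup>2 = 1"
      by (simp add: g11 g12 g22 cd)
    have "(r * d)\<^sup>2 + n2\<^sup>2 + q2\<^sup>2 = d\<^sup>2 * g11 + 2 * c * d * g12 + c\<^sup>2 * g22"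
      by (simp add: nqp gdefs power2_eq_square algebra_simps)
    then show "(r * d)\<^sup>2 + n2\<^sup>2 + q2\<^sup>2 = 1"
      using cd by (simp add: g11 g12 g22)
    have "r * c * (r * d) + n1 * n2 + q1 * q2 = c * d * (g11 - g22) + (c\<^sup>2 - d\<^sup>2) * g12"
      by (simp add: nqp gdefs power2_eq_square algebra_simps)
    then show "r * c * (r * d) + n1 * n2 + q1 * q2 = 0"
      by (simp add: g11 g12 g22)
    show "q1 * p1 + q2 * p2 = 0"
      by (simp add: nqp algebra_simps)
    have "(r * c * p1 + r * d * p2)\<^sup>2 = (r * x * (c\<^sup>2 + d\<^sup>2))\<^sup>2"
      by (simp add: nqp power2_eq_square algebra_simps)
    also have "\<dots> = s * x\<^sup>2"
      by (simp add: cd power_mult_distrib r)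
    finally have mp: "(r * c * p1 + r * d * p2)\<^sup>2 = 1 / 2"
      using xy(2) by simp
    have "n1 * p1 + n2 * p2 = h * (x\<^sup>2 + y\<^sup>2 - s * x\<^sup>2) * (c\<^sup>2 + d\<^sup>2)"
      by (simp add: nqp power2_eq_square algebra_simps)
    also have "\<dots> = h * (1 - s * x\<^sup>2)"
      by (simp add: cd xy(1))
    also have "\<dots> = h * (1 / 2)"
      using xy(2) by simp
    finally have "(n1 * p1 + n2 * p2)\<^sup>2 = 1 / 2"
      by (simp only: power_mult_distrib h) (simp add: power_divide)
    with mp show "(r * c * p1 + r * d * p2)\<^sup>2 = (n1 * p1 + n2 * p2)\<^sup>2"
      by simp
  qed
qed

text \<open>The Kraus operators \<open>|i><m| \<plusminus> |j><n|\<close> and \<open>|j><q|\<close> differ between the two channels only by a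
  phase flip of the output, which the classical action does not see.\<close>

lemma exists_two_distinguishable_channels:
  fixes e :: "2 \<Rightarrow> complex^2" and T :: "real^2^2"
  assumes e: "orthonormal_basis e" and "i \<noteq> j"
    and nonneg: "\<And>l. 0 \<le> T $ i $ l" and stoch: "\<And>l. T $ j $ l = 1 - T $ i $ l"
    and row: "1/2 \<le> T $ i $ 1 + T $ i $ 2" "T $ i $ 1 + T $ i $ 2 \<le> 1"
  obtains \<Phi> \<Psi> \<psi> where "quantum_channel \<Phi>" "has_classical_action e T \<Phi>"
    "quantum_channel \<Psi>" "has_classical_action e T \<Psi>" "norm \<psi> = 1"
    "orthogonal_supports (\<Phi> (ketbra \<psi> \<psi>)) (\<Psi> (ketbra \<psi> \<psi>))"
    "orthogonal_supports (\<Psi> (ketbra \<psi> \<psi>)) (\<Phi> (ketbra \<psi> \<psi>))"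
proof -
  obtain m1 m2 n1 n2 q1 q2 p1 p2 :: real where R:
    "m1\<^sup>2 = T $ i $ 1" "m2\<^sup>2 = T $ i $ 2" "p1\<^sup>2 + p2\<^sup>2 = 1"
    "m1\<^sup>2 + n1\<^sup>2 + q1\<^sup>2 = 1" "m2\<^sup>2 + n2\<^sup>2 + q2\<^sup>2 = 1" "m1 * m2 + n1 * n2 + q1 * q2 = 0"
    "q1 * p1 + q2 * p2 = 0" "(m1 * p1 + m2 * p2)\<^sup>2 = (n1 * p1 + n2 * p2)\<^sup>2"
    using rank_one_resolution[OF nonneg nonneg row] by metis
  have ee: "cinner (e k) (e l) = (if k = l then 1 else 0)" for k l
    using e by (simp add: orthonormal_basis_def)
  \<comment> \<open>Real coordinate pairs become vectors in the span of the basis, with the real dot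
    product as inner product, so the real identities carry over.\<close>
  define vec where "vec c d = complex_of_real c *s e 1 + complex_of_real d *s e 2" for c d
  have vv: "cinner (vec c d) (vec c' d') = complex_of_real (c * c' + d * d')" for c d c' d'
    by (simp add: vec_def cinner_simps ee)
  have ve: "cinner (vec c d) (e 1) = complex_of_real c" "cinner (vec c d) (e 2) = complex_of_real d"
    for c d
    by (simp_all add: vec_def cinner_simps ee)
  define \<psi> where "\<psi> = vec p1 p2"
  have "complex_of_real ((norm \<psi>)\<^sup>2) = 1"
    using R(3) unfolding cinner_self[symmetric] by (simp add: \<psi>_def vv power2_eq_square)
  then have \<psi>: "norm \<psi> = 1"
    by (simp add: abs_square_eq_1 flip: of_real_power)
  have res: "ketbra (vec m1 m2) (vec m1 m2) + ketbra (vec n1 n2) (vec n1 n2)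
      + ketbra (vec q1 q2) (vec q1 q2) = mat 1"
  proof -
    have "(ketbra (vec m1 m2) (vec m1 m2) + ketbra (vec n1 n2) (vec n1 n2)
        + ketbra (vec q1 q2) (vec q1 q2)) $ k $ l
      = complex_of_real (m1\<^sup>2 + n1\<^sup>2 + q1\<^sup>2) * (e 1 $ k * cnj (e 1 $ l))
      + complex_of_real (m2\<^sup>2 + n2\<^sup>2 + q2\<^sup>2) * (e 2 $ k * cnj (e 2 $ l))
      + complex_of_real (m1 * m2 + n1 * n2 + q1 * q2)
          * (e 1 $ k * cnj (e 2 $ l) + e 2 $ k * cnj (e 1 $ l))" for k l
      by (simp add: ketbra_def vec_def power2_eq_square algebra_simps)
    then show ?thesis
      unfolding R(4-6) using ketbra_sum_orthonormal_basis[OF e]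
      by (simp add: vec_eq_iff sum_2 ketbra_def)
  qed
  define K where "K \<sigma> b =
      (if b then ketbra (e i) (vec m1 m2) + ketbra (complex_of_real \<sigma> *s e j) (vec n1 n2)
       else ketbra (e j) (vec q1 q2))" for \<sigma> b
  define \<Phi> where "\<Phi> \<sigma> = kraus_map UNIV (K \<sigma>)" for \<sigma>
  have chan: "quantum_channel (\<Phi> \<sigma>)" if "\<sigma>\<^sup>2 = 1" for \<sigma>
  proof -
    \<comment> \<open>The cross terms vanish because \<open>e i\<close> and \<open>e j\<close> are
      orthogonal; the sign enters only squared.\<close>
    have "adjoint_matrix (K \<sigma> True) ** K \<sigma> True
        = ketbra (vec m1 m2) (vec m1 m2) + ketbra (vec n1 n2) (vec n1 n2)"
      using that \<open>i \<noteq> j\<close>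
      by (simp add: K_def adjoint_matrix_add adjoint_matrix_ketbra matrix_add_ldistrib
          matrix_mult_ketbra matrix_vector_mult_add_rdistrib ketbra_mult_vec cinner_simps ee
          power2_eq_square flip: of_real_mult)
    moreover have "adjoint_matrix (K \<sigma> False) ** K \<sigma> False = ketbra (vec q1 q2) (vec q1 q2)"
      by (simp add: K_def adjoint_matrix_ketbra matrix_mult_ketbra ketbra_mult_vec ee)
    ultimately show ?thesis
      unfolding \<Phi>_def by (intro quantum_channel_kraus_map) (use res in \<open>simp add: UNIV_bool ac_simps\<close>)
  qed
  have act: "has_classical_action e T (\<Phi> \<sigma>)" if "\<sigma>\<^sup>2 = 1" for \<sigma>
  proof -
    \<comment> \<open>On input \<open>l\<close>, outcome \<open>i\<close> has probability
      \<open>m_l^2\<close>, and outcome \<open>j\<close> has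
      \<open>n_l^2 + q_l^2 = 1 - m_l^2\<close>.\<close>
    have "(\<Sum>b\<in>UNIV. (cmod (cinner (e k) (K \<sigma> b *v e l)))\<^sup>2) = T $ k $ l" for k l
    proof -
      have "k = i \<or> k = j" "l = 1 \<or> l = 2"
        using \<open>i \<noteq> j\<close> exhaust_2 by metis+
      then show ?thesis
        using that R(1,2,4,5) \<open>i \<noteq> j\<close>
        by (auto simp: UNIV_bool K_def matrix_vector_mult_add_rdistrib ketbra_mult_vec cinner_simps
            ee ve stoch norm_mult power_mult_distrib)
    qed
    then show ?thesis
      by (simp add: has_classical_action_def \<Phi>_def classical_action_kraus_map)
  qed
  \<comment> \<open>As \<open>q\<close> is orthogonal to \<open>p\<close>, only the first Kraus
    operator acts on \<open>\<psi>\<close>; the output is pure and its support lies in one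
    line.\<close>
  have Kq: "K \<sigma> False *v \<psi> = 0" for \<sigma>
    using R(7) by (simp add: K_def \<psi>_def ketbra_mult_vec vv)
  have supp: "\<exists>c. u = c *s (K \<sigma> True *v \<psi>)" if "u \<in> support (\<Phi> \<sigma> (ketbra \<psi> \<psi>))" for u \<sigma>
    using that
    by (auto simp: support_def \<Phi>_def kraus_map_ketbra UNIV_bool Kq matrix_vector_mult_add_rdistrib
        ketbra_mult_vec)
  have orth: "orthogonal_supports (\<Phi> \<sigma> (ketbra \<psi> \<psi>)) (\<Phi> \<tau> (ketbra \<psi> \<psi>))" if "\<sigma> * \<tau> = - 1" for \<sigma> \<tau>
  proof -
    \<comment> \<open>The \<open>e i\<close> and \<open>e j\<close> components contribute equal
      weights with opposite signs, since \<open>\<sigma> * \<tau> = - 1\<close>.\<close>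
    have "cinner (K \<sigma> True *v \<psi>) (K \<tau> True *v \<psi>)
        = complex_of_real ((m1 * p1 + m2 * p2)\<^sup>2 + \<sigma> * \<tau> * (n1 * p1 + n2 * p2)\<^sup>2)"
      using \<open>i \<noteq> j\<close>
      by (simp add: K_def \<psi>_def matrix_vector_mult_add_rdistrib ketbra_mult_vec cinner_simps ee vv
          power2_eq_square) (simp add: algebra_simps)
    also have "\<dots> = 0"
      by (simp add: that R(8))
    finally show ?thesis
      unfolding orthogonal_supports_def by (auto dest!: supp simp: cinner_simps)
  qed
  show thesis
    using that[of "\<Phi> 1" "\<Phi> (- 1)" \<psi>] chan act \<psi> orth by simp
qed

section \<open>The maximum in each regime of \<open>a - b\<close>\<close>

theorem proposition25:
  fixes e :: "2 \<Rightarrow> complex^2" and a b :: real and T :: "real^2^2"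
  assumes "orthonormal_basis e"
    and "0 \<le> a" "a \<le> 1" "0 \<le> b" "b \<le> 1"
    and "T = vector [vector [a, 1 - b], vector [1 - a, b]]"
  shows "restricted_distinguishability_number e T =
           (if 1/2 < \<bar>a - b\<bar> then 1 else 2)"
proof -
  have T: "T $ 1 $ 1 = a" "T $ 1 $ 2 = 1 - b" "T $ 2 $ 1 = 1 - a" "T $ 2 $ 2 = b"
    by (simp_all add: assms(6))
  define \<S> where "\<S> = {S. finite S \<and> (\<forall>\<Phi>\<in>S. quantum_channel \<Phi> \<and> has_classical_action e T \<Phi>) \<and>
    perfectly_distinguishable_unentangled S}"
  have maxI: "restricted_distinguishability_number e T = enat N"
    if "S \<in> \<S>" "card S = N" "\<And>S. S \<in> \<S> \<Longrightarrow> card S \<le> N" for S N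
  proof -
    have "restricted_distinguishability_number e T = Sup ((\<lambda>S. enat (card S)) ` \<S>)"
      unfolding restricted_distinguishability_number_def \<S>_def
      by (intro arg_cong[of _ _ Sup]) auto
    also have "\<dots> = enat N"
      using that by (intro antisym SUP_least SUP_upper2[of S]) simp_all
    finally show ?thesis .
  qed
  show ?thesis
  proof (cases "1/2 < \<bar>a - b\<bar>")
    case True
    \<comment> \<open>The row sums are \<open>1 + (a - b)\<close> and \<open>1 - (a - b)\<close>, so
      the smaller one is \<open>1 - \<bar>a - b\<bar>\<close>.\<close>
    have "\<exists>k. (\<Sum>l\<in>UNIV. T $ k $ l) < 1 / 2"
    proof (cases "a \<le> b")
      case True
      with \<open>1/2 < \<bar>a - b\<bar>\<close> show ?thesis
        by (intro exI[of _ 1]) (simp add: sum_2 T)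
    next
      case False
      with \<open>1/2 < \<bar>a - b\<bar>\<close> show ?thesis
        by (intro exI[of _ 2]) (simp add: sum_2 T)
    qed
    then obtain k where k: "(\<Sum>l\<in>UNIV. T $ k $ l) < 1 / 2" ..
    have "0 \<le> T $ k $ l" "(\<Sum>k\<in>UNIV. T $ k $ l) = 1" for k l
      using exhaust_2[of k] exhaust_2[of l] assms(2-5) by (auto simp: T sum_2)
    then obtain \<Phi> where \<Phi>: "quantum_channel \<Phi>" "has_classical_action e T \<Phi>"
      using exists_channel_with_classical_action[OF assms(1), of T] by metis
    \<comment> \<open>For a single channel the pairwise condition is vacuous, so any unit vector
      serves as input.\<close>
    have "norm (axis 1 1 :: complex^2) = 1"
      by simp
    then have "perfectly_distinguishable_unentangled {\<Phi>}"
      unfolding perfectly_distinguishable_unentangled_def pairwise_def by blast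
    with \<Phi> have "{\<Phi>} \<in> \<S>"
      by (simp add: \<S>_def)
    moreover have "card S \<le> 1" if "S \<in> \<S>" for S
      using that by (intro card_distinguishable_le_1[OF assms(1) _ _ _ _ k]) (auto simp: \<S>_def)
    ultimately show ?thesis
      using True maxI[of "{\<Phi>}" 1] by (simp add: one_enat_def)
  next
    case False
    \<comment> \<open>Row \<open>i\<close> is the one with the smaller sum
      \<open>1 - \<bar>a - b\<bar>\<close>, which now lies between \<open>1/2\<close> and 1.\<close>
    have "\<exists>i j. i \<noteq> j \<and> (\<forall>l. 0 \<le> T $ i $ l \<and> T $ j $ l = 1 - T $ i $ l) \<and>
        1/2 \<le> T $ i $ 1 + T $ i $ 2 \<and> T $ i $ 1 + T $ i $ 2 \<le> 1"
    proof (cases "a \<le> b")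
      case True
      with False assms(2-5) show ?thesis
        by (intro exI[of _ 1] exI[of _ 2]) (simp add: forall_2 T)
    next
      assume "\<not> a \<le> b"
      with False assms(2-5) show ?thesis
        by (intro exI[of _ 2] exI[of _ 1]) (simp add: forall_2 T)
    qed
    then obtain i j where "i \<noteq> j" "\<And>l. 0 \<le> T $ i $ l" "\<And>l. T $ j $ l = 1 - T $ i $ l"
      "1/2 \<le> T $ i $ 1 + T $ i $ 2" "T $ i $ 1 + T $ i $ 2 \<le> 1"
      by blast
    then obtain \<Phi> \<Psi> \<psi> where C: "quantum_channel \<Phi>" "has_classical_action e T \<Phi>"
      "quantum_channel \<Psi>" "has_classical_action e T \<Psi>" "norm \<psi> = 1"
      "orthogonal_supports (\<Phi> (ketbra \<psi> \<psi>)) (\<Psi> (ketbra \<psi> \<psi>))"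
      "orthogonal_supports (\<Psi> (ketbra \<psi> \<psi>)) (\<Phi> (ketbra \<psi> \<psi>))"
      using exists_two_distinguishable_channels[OF assms(1)] by metis
    have "\<Phi> \<noteq> \<Psi>"
      using C(6) orthogonal_supports_self trace_channel_output[OF C(1,5)] by force
    have "perfectly_distinguishable_unentangled {\<Phi>, \<Psi>}"
      unfolding perfectly_distinguishable_unentangled_def
      using C(5-7) by (intro exI[of _ \<psi>]) (auto simp: pairwise_def)
    with C have "{\<Phi>, \<Psi>} \<in> \<S>"
      by (simp add: \<S>_def)
    moreover have "card S \<le> 2" if "S \<in> \<S>" for S
      using that by (intro card_distinguishable_le_2) (auto simp: \<S>_def)
    ultimately show ?thesis
      using False maxI[of "{\<Phi>, \<Psi>}" 2] \<open>\<Phi> \<noteq> \<Psi>\<close> by (simp add: numeral_eq_enat)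
  qed
qed

end
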